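(* Let $X,Y$ be topological spaces and let $f:X\to Y$ be a continuous map. If $X$ or $Y$ is a sphere $S^m$ (for some $m\ge 0$), then $\mathrm{cat}(f)\in\{1,2\}$.
   Context: $S^m$ is the unit sphere in $\mathbb{R}^{m+1}$. A continuous map is null-homotopic if it is (freely) homotopic to a constant map. The category $\mathrm{cat}(f)$ of a continuous map $f:X\to Y$ is the least positive integer $n$ such that $X$ is a union of open subsets $U_1,\dots,U_n$ with each restriction $f_{|U_i}:U_i\to Y$ null-homotopic, and $\infty$ if no such integer exists. *)

theory Defs
  imports "HOL-Analysis.Analysis" "HOL-Library.Extended_Nat"
begin

text \<open>Free homotopy to a constant map. The value \<open>c\<close> must lie in \<open>Y\<close>: this is not automatic
  when \<open>X\<close> is empty.\<close>

definition null_homotopic_map :: "'a topology \<Rightarrow> 'b topology \<Rightarrow> ('a \<Rightarrow> 'b) \<Rightarrow> bool" where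
  "null_homotopic_map X Y f \<longleftrightarrow>
     (\<exists>c \<in> topspace Y. homotopic_with (\<lambda>_. True) X Y f (\<lambda>_. c))"

definition has_null_homotopic_cover :: "'a topology \<Rightarrow> 'b topology \<Rightarrow> ('a \<Rightarrow> 'b) \<Rightarrow> nat \<Rightarrow> bool" where
  "has_null_homotopic_cover X Y f n \<longleftrightarrow>
     (\<exists>U :: nat \<Rightarrow> 'a set.
        (\<forall>i\<in>{1..n}. openin X (U i) \<and> null_homotopic_map (subtopology X (U i)) Y f) \<and>
        topspace X = (\<Union>i\<in>{1..n}. U i))"

definition map_cat :: "'a topology \<Rightarrow> 'b topology \<Rightarrow> ('a \<Rightarrow> 'b) \<Rightarrow> enat" where
  "map_cat X Y f =
     (if \<exists>n\<ge>1. has_null_homotopic_cover X Y f n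
      then enat (LEAST n. n \<ge> 1 \<and> has_null_homotopic_cover X Y f n)
      else \<infinity>)"

end

theory Submission
  imports Defs
begin

text \<open>If \<open>X\<close> or \<open>Y\<close> is a sphere, then \<open>f\<close> factors as \<open>X \<rightarrow> S \<rightarrow> Y\<close> through a sphere \<open>S\<close>.
  A map into a sphere that misses a point \<open>a\<close> contracts along great circles to \<open>- a\<close>,
  so removing from \<open>X\<close> the preimages of one, resp. the other, of two distinct points of \<open>S\<close>
  gives an open cover of \<open>X\<close> by two sets on which \<open>f\<close> is null-homotopic.\<close>

lemma null_homotopic_map_into_nsphere_missing_point:
  assumes f: "continuous_map W (nsphere p) f"
    and a: "a \<in> topspace (nsphere p)" "a \<notin> f ` topspace W"
  shows "null_homotopic_map W (nsphere p) f"
proof -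
  have a1: "(\<Sum>i\<le>p. (a i)\<^sup>2) = 1" and a0: "\<And>i. i > p \<Longrightarrow> a i = 0"
    using a(1) by (simp_all add: nsphere)
  have fS: "f x \<in> topspace (nsphere p)" if "x \<in> topspace W" for x
    using continuous_map_image_subset_topspace f that by blast
  have f1: "(\<Sum>j\<le>p. (f x j)\<^sup>2) = 1" and f0: "\<And>i. i > p \<Longrightarrow> f x i = 0" if "x \<in> topspace W" for x
    using fS[OF that] by (simp_all add: nsphere)
  \<comment> \<open>For fixed \<open>x\<close>, \<open>u\<close> runs along the straight segment
    from \<open>f x\<close> to \<open>- a\<close>; dividing by its Euclidean norm \<open>N\<close>
    projects it radially to the sphere.\<close>
  define u where "u \<equiv> \<lambda>(t::real, x) i. (1 - t) * f x i - t * a i"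
  define N where "N \<equiv> \<lambda>z. sqrt (\<Sum>j\<le>p. (u z j)\<^sup>2)"
  let ?T = "prod_topology (top_of_set {0..1::real}) W"
  \<comment> \<open>The segment avoids the origin: otherwise \<open>(1 - t) * f x = t * a\<close>,
    and comparing norms of these multiples of unit vectors forces \<open>t = 1/2\<close>, hence
    \<open>f x = a\<close>, a value that \<open>f\<close> misses.\<close>
  have sum_nz: "(\<Sum>j\<le>p. (u z j)\<^sup>2) \<noteq> 0" if z: "z \<in> topspace ?T" for z
  proof
    assume eq: "(\<Sum>j\<le>p. (u z j)\<^sup>2) = 0"
    obtain t x where tx: "z = (t, x)" "x \<in> topspace W"
      using z by auto
    have u0: "(1 - t) * f x i = t * a i" if "i \<le> p" for i
      using eq that tx by (simp add: sum_nonneg_eq_0_iff u_def)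
    have "(1 - t)\<^sup>2 = (\<Sum>i\<le>p. ((1 - t) * f x i)\<^sup>2)"
      using f1[OF tx(2)] by (simp add: power_mult_distrib flip: sum_distrib_left)
    also have "\<dots> = (\<Sum>i\<le>p. (t * a i)\<^sup>2)"
      using u0 by simp
    also have "\<dots> = t\<^sup>2"
      using a1 by (simp add: power_mult_distrib flip: sum_distrib_left)
    finally have "1 - t = t"
      by (simp add: power2_eq_iff)
    then have t: "t = 1/2"
      by simp
    have "f x i = a i" for i
      using u0[of i] a0[of i] f0[OF tx(2), of i] unfolding t by (cases "i \<le> p") auto
    then show False
      using a(2) tx(2) by (metis ext image_eqI)
  qed
  have fi: "continuous_map ?T euclideanreal (\<lambda>z. f (snd z) i)" for i
    using continuous_map_compose[OF continuous_map_compose[OF continuous_map_snd f]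
        continuous_map_nsphere_projection[of p i]]
    by (simp add: o_def)
  have ui: "continuous_map ?T euclideanreal (\<lambda>z. u z i)" for i
    unfolding u_def case_prod_unfold
    by (intro continuous_intros fi continuous_map_into_fulltopology[OF continuous_map_fst])
  have "continuous_map ?T (nsphere p) (\<lambda>z i. u z i / N z)"
    unfolding nsphere continuous_map_in_subtopology
  proof (intro conjI)
    show "continuous_map ?T (powertop_real UNIV) (\<lambda>z i. u z i / N z)"
      unfolding continuous_map_componentwise_UNIV N_def
      by (intro allI continuous_intros ui) (use sum_nz in auto)
    have "(\<Sum>i\<le>p. (u z i / N z)\<^sup>2) = 1" if "z \<in> topspace ?T" for z
      using sum_nz[OF that]
      by (simp add: N_def power_divide sum_nonneg flip: sum_divide_distrib)
    \<comment> \<open>\<open>N\<close> sees only the coordinates up to \<open>p\<close>; the others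
      must vanish for the quotient to lie on the sphere.\<close>
    moreover have "u z i = 0" if "z \<in> topspace ?T" "i > p" for z i
      using that a0 f0 by (auto simp: u_def)
    ultimately show "(\<lambda>z i. u z i / N z) \<in> topspace ?T \<rightarrow>
        {x. (\<Sum>i\<le>p. (x i)\<^sup>2) = 1 \<and> (\<forall>i>p. x i = 0)}"
      by (simp add: Pi_iff)
  qed
  moreover have "(\<lambda>i. u (0, x) i / N (0, x)) = f x" if "x \<in> topspace W" for x
    using f1[OF that] by (simp add: u_def N_def)
  moreover have "(\<lambda>i. u (1, x) i / N (1, x)) = (\<lambda>i. - a i)" for x
    using a1 by (simp add: u_def N_def)
  ultimately have "homotopic_with (\<lambda>_. True) W (nsphere p) f (\<lambda>_. (\<lambda>i. - a i))"
    by (subst homotopic_with) (simp, intro exI[of _ "\<lambda>z i. u z i / N z"], simp)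
  \<comment> \<open>This supplies the constant in the target even when \<open>W\<close> is
    empty.\<close>
  moreover have "(\<lambda>i. - a i) \<in> topspace (nsphere p)"
    using a1 a0 by (simp add: nsphere)
  ultimately show ?thesis
    unfolding null_homotopic_map_def by blast
qed

lemma null_homotopic_map_compose_left:
  assumes "null_homotopic_map X Y f" "continuous_map Y Z g"
  shows "null_homotopic_map X Z (g \<circ> f)"
proof -
  obtain c where c: "c \<in> topspace Y" "homotopic_with (\<lambda>_. True) X Y f (\<lambda>_. c)"
    using assms(1) unfolding null_homotopic_map_def by blast
  have "homotopic_with (\<lambda>_. True) X Z (g \<circ> f) (g \<circ> (\<lambda>_. c))"
    by (rule homotopic_with_compose_continuous_map_left[OF c(2) assms(2)]) simp
  moreover have "g c \<in> topspace Z"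
    using continuous_map_image_subset_topspace[OF assms(2)] c(1) by blast
  ultimately show ?thesis
    unfolding null_homotopic_map_def o_def by (rule bexI)
qed

lemma null_homotopic_map_eq:
  assumes "null_homotopic_map X Y f" "\<And>x. x \<in> topspace X \<Longrightarrow> g x = f x"
  shows "null_homotopic_map X Y g"
proof -
  obtain c where c: "c \<in> topspace Y" "homotopic_with (\<lambda>_. True) X Y f (\<lambda>_. c)"
    using assms(1) unfolding null_homotopic_map_def by blast
  have "homotopic_with (\<lambda>_. True) X Y g (\<lambda>_. c)"
    by (rule homotopic_with_eq[OF c(2)]) (use assms(2) in auto)
  with c(1) show ?thesis
    unfolding null_homotopic_map_def by blast
qed

text \<open>The first basis vector and its antipode serve for every \<open>m\<close>; for
  \<open>m = 0\<close> they are the whole sphere.\<close>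

lemma nsphere_two_points:
  obtains a b where "a \<in> topspace (nsphere m)" "b \<in> topspace (nsphere m)" "a \<noteq> b"
proof
  let ?e = "\<lambda>n. if n = 0 then 1 else 0 :: real"
  show "?e \<in> topspace (nsphere m)"
    by (rule in_topspace_nsphere)
  then show "(\<lambda>n. - ?e n) \<in> topspace (nsphere m)"
    unfolding nsphere by simp
  show "?e \<noteq> (\<lambda>n. - ?e n)"
    by (auto simp: fun_eq_iff intro!: exI[of _ 0])
qed

text \<open>Handles both cases at once: the sphere may sit at the source (\<open>q\<close> a
  homeomorphism) or at the target (\<open>r\<close> a homeomorphism).\<close>

lemma has_null_homotopic_cover_2_via_nsphere:
  assumes q: "continuous_map X (nsphere m) q"
    and r: "continuous_map (nsphere m) Y r"
    and f: "\<And>x. x \<in> topspace X \<Longrightarrow> f x = r (q x)"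
  shows "has_null_homotopic_cover X Y f 2"
proof -
  \<comment> \<open>\<open>?U a\<close> is the complement of the fibre of \<open>q\<close> over
    \<open>a\<close>, written as a preimage of an open set.\<close>
  let ?U = "\<lambda>a. {x \<in> topspace X. q x \<in> topspace (nsphere m) - {a}}"
  have "Hausdorff_space (nsphere m)"
    unfolding nsphere_def by (intro Hausdorff_space_subtopology Hausdorff_Euclidean_space)
  then have "openin (nsphere m) (topspace (nsphere m) - {a})" for a
    \<comment> \<open>If \<open>a\<close> is off the sphere, nothing is removed and the set is the
      whole space.\<close>
    by (cases "a \<in> topspace (nsphere m)")
      (auto intro!: openin_diff closedin_Hausdorff_singleton)
  then have op: "openin X (?U a)" for a
    using openin_continuous_map_preimage[OF q] by blast
  have null: "null_homotopic_map (subtopology X (?U a)) Y f" if "a \<in> topspace (nsphere m)" for a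
  proof (rule null_homotopic_map_eq)
    show "null_homotopic_map (subtopology X (?U a)) Y (r \<circ> q)"
      by (rule null_homotopic_map_compose_left[OF _ r],
          rule null_homotopic_map_into_nsphere_missing_point[OF _ that])
        (use q in \<open>auto intro: continuous_map_from_subtopology\<close>)
  qed (use f in auto)
  obtain a b where ab: "a \<in> topspace (nsphere m)" "b \<in> topspace (nsphere m)" "a \<noteq> b"
    by (rule nsphere_two_points)
  \<comment> \<open>No \<open>q x\<close> equals both \<open>a\<close> and \<open>b\<close>, so
    every point lies in one of the two sets.\<close>
  have "topspace X = ?U b \<union> ?U a"
    using ab(3) continuous_map_image_subset_topspace[OF q] by auto
  moreover have "{1..2::nat} = {1, 2}"
    by auto
  ultimately show ?thesis
    unfolding has_null_homotopic_cover_def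
    by (intro exI[of _ "\<lambda>i::nat. if i = 1 then ?U a else ?U b"])
      (use op null[OF ab(1)] null[OF ab(2)] in simp)
qed

text \<open>The cover makes the category finite and at most 2; the bound from below is built into
  the minimum.\<close>

lemma map_cat_cases_of_cover_2:
  assumes "has_null_homotopic_cover X Y f 2"
  shows "map_cat X Y f \<in> {1, 2}"
proof -
  let ?P = "\<lambda>n. n \<ge> 1 \<and> has_null_homotopic_cover X Y f n"
  have P2: "?P 2"
    using assms by simp
  have "(LEAST n. ?P n) \<ge> 1" "(LEAST n. ?P n) \<le> 2"
    using LeastI[of ?P, OF P2] Least_le[of ?P, OF P2] by auto
  then have "(LEAST n. ?P n) = 1 \<or> (LEAST n. ?P n) = 2"
    by linarith
  moreover have "map_cat X Y f = enat (LEAST n. ?P n)"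
    using P2 unfolding map_cat_def by (intro if_P exI)
  ultimately show ?thesis
    by (auto simp: one_enat_def numeral_eq_enat)
qed

theorem mainTheorem16:
  fixes X :: "'a topology" and Y :: "'b topology" and f :: "'a \<Rightarrow> 'b"
  assumes "continuous_map X Y f"
    and "(\<exists>m. X homeomorphic_space nsphere m) \<or> (\<exists>m. Y homeomorphic_space nsphere m)"
  shows "map_cat X Y f \<in> {1, 2}"
  using assms(2)
proof (elim disjE exE)
  fix m
  assume "X homeomorphic_space nsphere m"
  then obtain h k where "homeomorphic_maps X (nsphere m) h k"
    unfolding homeomorphic_space_def by blast
  then have h: "continuous_map X (nsphere m) h" and k: "continuous_map (nsphere m) X k"
    and kh: "\<And>x. x \<in> topspace X \<Longrightarrow> k (h x) = x"
    by (auto simp: homeomorphic_maps_def)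
  \<comment> \<open>Here \<open>f\<close> factors as \<open>f \<circ> k\<close> after
    \<open>h\<close>.\<close>
  show ?thesis
    by (rule map_cat_cases_of_cover_2, rule has_null_homotopic_cover_2_via_nsphere
          [OF h continuous_map_compose[OF k assms(1)]]) (simp add: kh)
next
  fix m
  assume "Y homeomorphic_space nsphere m"
  then obtain h k where "homeomorphic_maps Y (nsphere m) h k"
    unfolding homeomorphic_space_def by blast
  then have h: "continuous_map Y (nsphere m) h" and k: "continuous_map (nsphere m) Y k"
    and kh: "\<And>y. y \<in> topspace Y \<Longrightarrow> k (h y) = y"
    by (auto simp: homeomorphic_maps_def)
  \<comment> \<open>Now \<open>f\<close> factors as \<open>k\<close> after
    \<open>h \<circ> f\<close>; \<open>k\<close> is known to undo \<open>h\<close> only on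
    \<open>topspace Y\<close>, so the values of \<open>f\<close> must be placed there.\<close>
  have "f x \<in> topspace Y" if "x \<in> topspace X" for x
    using continuous_map_image_subset_topspace[OF assms(1)] that by blast
  then show ?thesis
    by (intro map_cat_cases_of_cover_2 has_null_homotopic_cover_2_via_nsphere
          [OF continuous_map_compose[OF assms(1) h] k]) (simp add: kh)
qed

end
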